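(* Let $(V,\nu,\tau,\tau^* )$ be a PN space with null vector $\theta$, and let $f\colon V\to V$ be a $C$-contraction. Then: (i) For any real number $\epsilon>0$ there exists $n_0=n_0(\epsilon)\in\mathbb{N}$ such that for all $n>n_0$ and for every $p\in V$ one has $f^np\in N_\theta(\epsilon)$. (ii) $f$ has at most one fixed point, and the only possible fixed point is the null vector $\theta$ of $V$. Moreover, if $f$ is a linear mapping, then $f$ has exactly one fixed point.
   Context: A distance distribution function (d.d.f.) is a nondecreasing function $F\colon[0,+\infty]\to[0,1]$, left-continuous on $(0,+\infty)$, with $F(0)=0$ and $F(+\infty)=1$; $\Delta^+$ is the set of all d.d.f.'s, ordered pointwise. $\varepsilon_0\in\Delta^+$ is the d.d.f. with $\varepsilon_0(0)=0$ and $\varepsilon_0(x)=1$ for $x>0$. A triangle function is a map $\tau\colon\Delta^+\times\Delta^+\to\Delta^+$ that is commutative, associative, nondecreasing in each variable, and has $\varepsilon_0$ as identity. A PN space $(V,\nu,\tau,\tau^* )$ consists of a real vector space $V$ (null vector $\theta$), a map $\nu\colon V\to\Delta^+$, $p\mapsto\nu_p$, and triangle functions $\tau,\tau^*$ such that for all $p,q\in V$: (N1) $\nu_p=\varepsilon_0$ if and only if $p=\theta$; (N2) $\nu_{-p}=\nu_p$; (N3) $\nu_{p+q}\ge\tau(\nu_p,\nu_q)$; (N4) $\nu_p\le\tau^*(\nu_{\lambda p},\nu_{(1-\lambda)p})$ for every $\lambda\in[0,1]$. For $p\in V$ and $t>0$, $N_p(t)=\{q\in V\colon \nu_{p-q}(t)>1-t\}$.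 A map $f\colon V\to V$ (not assumed linear) is a $C$-contraction if there exists $k\in(0,1)$ such that for all $p\in V$ and $t>0$: $\nu_p(t)>1-t$ implies $\nu_{fp}(kt)>1-kt$. Here $f^n$ denotes the $n$-th iterate of $f$. *)

theory Defs
  imports "HOL-Analysis.Analysis"
begin

definition distance_distribution_functions :: "(ennreal \<Rightarrow> real) set"  ("\<Delta>\<^sup>+")
  where "\<Delta>\<^sup>+ = {F. (\<forall>x. F x \<in> {0..1}) \<and> mono F \<and>
            (\<forall>x. 0 < x \<and> x < \<infinity> \<longrightarrow> continuous (at_left x) F) \<and>
            F 0 = 0 \<and> F \<infinity> = 1}"

definition ddf_zero :: "ennreal \<Rightarrow> real"  ("\<epsilon>\<^sub>0")
  where "\<epsilon>\<^sub>0 x = (if x = 0 then 0 else 1)"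

text \<open>Triangle functions are binary operations on \<^term>\<open>\<Delta>\<^sup>+\<close>; their values outside this set are
  irrelevant. The order on \<^term>\<open>\<Delta>\<^sup>+\<close> is the pointwise order of the function type.\<close>

definition triangle_function ::
    "((ennreal \<Rightarrow> real) \<Rightarrow> (ennreal \<Rightarrow> real) \<Rightarrow> (ennreal \<Rightarrow> real)) \<Rightarrow> bool"
  where "triangle_function \<tau> \<longleftrightarrow>
    (\<forall>F\<in>\<Delta>\<^sup>+. \<forall>G\<in>\<Delta>\<^sup>+. \<tau> F G \<in> \<Delta>\<^sup>+) \<and>
    (\<forall>F\<in>\<Delta>\<^sup>+. \<forall>G\<in>\<Delta>\<^sup>+. \<tau> F G = \<tau> G F) \<and>
    (\<forall>F\<in>\<Delta>\<^sup>+. \<forall>G\<in>\<Delta>\<^sup>+. \<forall>H\<in>\<Delta>\<^sup>+. \<tau> (\<tau> F G) H = \<tau> F (\<tau> G H)) \<and>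
    (\<forall>F\<in>\<Delta>\<^sup>+. \<forall>G\<in>\<Delta>\<^sup>+. \<forall>H\<in>\<Delta>\<^sup>+. F \<le> G \<longrightarrow> \<tau> F H \<le> \<tau> G H \<and> \<tau> H F \<le> \<tau> H G) \<and>
    (\<forall>F\<in>\<Delta>\<^sup>+. \<tau> \<epsilon>\<^sub>0 F = F \<and> \<tau> F \<epsilon>\<^sub>0 = F)"

locale PN_space =
  fixes \<nu> :: "'a::real_vector \<Rightarrow> ennreal \<Rightarrow> real"
    and \<tau> \<tau>' :: "(ennreal \<Rightarrow> real) \<Rightarrow> (ennreal \<Rightarrow> real) \<Rightarrow> (ennreal \<Rightarrow> real)"
  assumes ddf: "\<nu> p \<in> \<Delta>\<^sup>+"
    and triangle_\<tau>: "triangle_function \<tau>"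
    and triangle_\<tau>': "triangle_function \<tau>'"
    and N1: "\<nu> p = \<epsilon>\<^sub>0 \<longleftrightarrow> p = 0"
    and N2: "\<nu> (- p) = \<nu> p"
    and N3: "\<tau> (\<nu> p) (\<nu> q) \<le> \<nu> (p + q)"
    and N4: "c \<in> {0..1} \<Longrightarrow> \<nu> p \<le> \<tau>' (\<nu> (c *\<^sub>R p)) (\<nu> ((1 - c) *\<^sub>R p))"

definition PN_neighbourhood :: "('a::real_vector \<Rightarrow> ennreal \<Rightarrow> real) \<Rightarrow> 'a \<Rightarrow> real \<Rightarrow> 'a set"
  where "PN_neighbourhood \<nu> p t = {q. \<nu> (p - q) (ennreal t) > 1 - t}"

definition C_contraction :: "('a::real_vector \<Rightarrow> ennreal \<Rightarrow> real) \<Rightarrow> ('a \<Rightarrow> 'a) \<Rightarrow> bool"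
  where "C_contraction \<nu> f \<longleftrightarrow>
    (\<exists>k::real. 0 < k \<and> k < 1 \<and>
      (\<forall>p. \<forall>t>0. \<nu> p (ennreal t) > 1 - t \<longrightarrow> \<nu> (f p) (ennreal (k * t)) > 1 - k * t))"

end

theory Submission imports Defs begin

text \<open>
  The contraction condition has a hypothesis that is vacuous for large \<open>t\<close>: a distance
  distribution function is nonnegative, so \<open>\<nu> p t > 1 - t\<close> holds for every \<open>p\<close> as soon as
  \<open>t > 1\<close>. Iterating the contraction from such a \<open>t\<close> gives \<open>\<nu> (f\<^sup>n p) (k\<^sup>n t) > 1 - k\<^sup>n t\<close>
  with \<open>k\<^sup>n t\<close> tending to \<open>0\<close> at a rate that does not depend on \<open>p\<close>; this is the uniform
  statement \<open>iterate_eventually_in_neighbourhood\<close>.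

  A fixed point equals all its iterates, so it lies in every neighbourhood of the null vector. This
  forces its distribution function to be \<open>\<epsilon>\<^sub>0\<close>, hence the point to be \<open>0\<close>
  (\<open>eq_zero_if_in_all_neighbourhoods\<close>). A linear map fixes \<open>0\<close>.
\<close>

context PN_space
begin

lemma nonneg: "0 \<le> \<nu> p x"
  and le_one: "\<nu> p x \<le> 1"
  and at_zero: "\<nu> p 0 = 0"
  and mono_\<nu>: "x \<le> y \<Longrightarrow> \<nu> p x \<le> \<nu> p y"
  using ddf[of p] by (auto simp: distance_distribution_functions_def mono_def)

lemma in_neighbourhood_zero_iff: "q \<in> PN_neighbourhood \<nu> 0 t \<longleftrightarrow> 1 - t < \<nu> q (ennreal t)"
  by (simp add: PN_neighbourhood_def N2)

lemma neighbourhood_zero_mono: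
  assumes "s \<le> t"
  shows "PN_neighbourhood \<nu> 0 s \<subseteq> PN_neighbourhood \<nu> 0 t"
proof
  fix q assume "q \<in> PN_neighbourhood \<nu> 0 s"
  then show "q \<in> PN_neighbourhood \<nu> 0 t"
    using assms mono_\<nu>[OF ennreal_leI[OF assms], of q] by (simp add: in_neighbourhood_zero_iff)
qed

text \<open>
  Membership for all small \<open>t\<close> gives \<open>\<nu> p 0+ = 1\<close>, so by monotonicity \<open>\<nu> p\<close> is constantly
  \<open>1\<close> off \<open>0\<close>, which characterises the null vector.
\<close>

lemma eq_zero_if_in_all_neighbourhoods:
  assumes "\<And>t. 0 < t \<Longrightarrow> p \<in> PN_neighbourhood \<nu> 0 t"
  shows "p = 0"
proof -
  have "\<nu> p x = 1" if "0 < x" for x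
  proof (rule antisym[OF le_one])
    show "1 \<le> \<nu> p x"
    proof (rule field_le_epsilon)
      fix e :: real assume e: "0 < e"
      \<comment> \<open>Any \<open>d\<close> with \<open>0 < d \<le> e\<close> and \<open>d \<le> x\<close> serves; \<open>x\<close> may be infinite.\<close>
      obtain d :: real where d: "0 < d" "d \<le> e" "ennreal d \<le> x"
      proof (cases x)
        case (real r)
        then show ?thesis
          using e \<open>0 < x\<close> by (intro that[of "min e r"]) (auto intro: ennreal_leI)
      next
        case top
        then show ?thesis using e by (intro that[of e]) auto
      qed
      have "1 - d < \<nu> p (ennreal d)"
        using assms[OF d(1)] by (simp add: in_neighbourhood_zero_iff)
      also have "\<dots> \<le> \<nu> p x" by (rule mono_\<nu>[OF d(3)])
      finally show "1 \<le> \<nu> p x + e" using d(2) by simp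
    qed
  qed
  then have "\<nu> p = \<epsilon>\<^sub>0" by (auto simp: fun_eq_iff ddf_zero_def at_zero zero_less_iff_neq_zero)
  then show ?thesis by (simp add: N1)
qed

text \<open>
  The hypothesis \<open>1 < t\<close> starts the induction: the neighbourhood of radius \<open>t\<close> is then the whole
  space, which is why \<open>p\<close> is arbitrary.
\<close>

lemma iterate_in_shrinking_neighbourhood:
  assumes "0 < k"
    and step: "\<And>p t. 0 < t \<Longrightarrow> 1 - t < \<nu> p (ennreal t) \<Longrightarrow> 1 - k * t < \<nu> (f p) (ennreal (k * t))"
    and "1 < t"
  shows "(f ^^ n) p \<in> PN_neighbourhood \<nu> 0 (k ^ n * t)"
proof (induction n)
  case 0
  have "1 - t < \<nu> p (ennreal t)" using nonneg[of p "ennreal t"] \<open>1 < t\<close> by linarith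
  then show ?case by (simp add: in_neighbourhood_zero_iff)
next
  case (Suc n)
  have "0 < k ^ n * t" using assms by simp
  from step[OF this] Suc.IH show ?case by (simp add: in_neighbourhood_zero_iff mult.assoc)
qed

lemma iterate_eventually_in_neighbourhood:
  assumes "C_contraction \<nu> f" and "0 < \<epsilon>"
  shows "\<exists>n\<^sub>0. \<forall>n>n\<^sub>0. \<forall>p. (f ^^ n) p \<in> PN_neighbourhood \<nu> 0 \<epsilon>"
proof -
  obtain k :: real where k: "0 < k" "k < 1"
    and step: "\<And>p t. 0 < t \<Longrightarrow> 1 - t < \<nu> p (ennreal t) \<Longrightarrow> 1 - k * t < \<nu> (f p) (ennreal (k * t))"
    using assms(1) unfolding C_contraction_def by blast
  \<comment> \<open>The iteration starts at radius \<open>2\<close>, an arbitrary choice above \<open>1\<close>.\<close>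
  obtain n\<^sub>0 where n\<^sub>0: "k ^ n\<^sub>0 < \<epsilon> / 2"
    using real_arch_pow_inv[of "\<epsilon> / 2" k] assms(2) k by auto
  have "(f ^^ n) p \<in> PN_neighbourhood \<nu> 0 \<epsilon>" if "n\<^sub>0 < n" for n p
  proof -
    have "k ^ n \<le> k ^ n\<^sub>0" using k that by (intro power_decreasing) auto
    then have "k ^ n * 2 \<le> \<epsilon>" using n\<^sub>0 by linarith
    moreover have "(f ^^ n) p \<in> PN_neighbourhood \<nu> 0 (k ^ n * 2)"
      by (rule iterate_in_shrinking_neighbourhood[OF k(1) step]) auto
    ultimately show ?thesis using neighbourhood_zero_mono by blast
  qed
  then show ?thesis by blast
qed

lemma fixed_point_eq_zero:
  assumes "C_contraction \<nu> f" and "f p = p"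
  shows "p = 0"
proof (rule eq_zero_if_in_all_neighbourhoods)
  fix t :: real assume "0 < t"
  then obtain n\<^sub>0 where "\<forall>n>n\<^sub>0. \<forall>p. (f ^^ n) p \<in> PN_neighbourhood \<nu> 0 t"
    using iterate_eventually_in_neighbourhood[OF assms(1)] by blast
  then have "(f ^^ Suc n\<^sub>0) p \<in> PN_neighbourhood \<nu> 0 t" by blast
  moreover have "(f ^^ n) p = p" for n by (induction n) (simp_all add: assms(2))
  ultimately show "p \<in> PN_neighbourhood \<nu> 0 t" by metis
qed

end

theorem theorem4p1:
  fixes \<nu> :: "'a::real_vector \<Rightarrow> ennreal \<Rightarrow> real"
    and \<tau> \<tau>' :: "(ennreal \<Rightarrow> real) \<Rightarrow> (ennreal \<Rightarrow> real) \<Rightarrow> (ennreal \<Rightarrow> real)"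
    and f :: "'a \<Rightarrow> 'a"
  assumes "PN_space \<nu> \<tau> \<tau>'"
    and "C_contraction \<nu> f"
  shows "(\<forall>\<epsilon>::real. \<epsilon> > 0 \<longrightarrow>
            (\<exists>n\<^sub>0::nat. \<forall>n>n\<^sub>0. \<forall>p. (f ^^ n) p \<in> PN_neighbourhood \<nu> 0 \<epsilon>)) \<and>
         (\<exists>\<^sub>\<le>\<^sub>1p. f p = p) \<and>
         (\<forall>p. f p = p \<longrightarrow> p = 0) \<and>
         (linear f \<longrightarrow> (\<exists>!p. f p = p))"
proof -
  interpret PN_space \<nu> \<tau> \<tau>' by (fact assms(1))
  have zero: "p = 0" if "f p = p" for p
    using fixed_point_eq_zero[OF assms(2) that] .
  show ?thesis
  proof (intro conjI allI impI)
    show "\<exists>n\<^sub>0. \<forall>n>n\<^sub>0. \<forall>p. (f ^^ n) p \<in> PN_neighbourhood \<nu> 0 \<epsilon>" if "0 < \<epsilon>" for \<epsilon>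
      using iterate_eventually_in_neighbourhood[OF assms(2) that] .
    show "\<exists>\<^sub>\<le>\<^sub>1p. f p = p"
    proof (rule Uniq_I)
      fix p q assume "f p = p" and "f q = q"
      then show "q = p" using zero[of p] zero[of q] by simp
    qed
    show "p = 0" if "f p = p" for p using zero[OF that] .
    show "\<exists>!p. f p = p" if "linear f" using linear_0[OF that] zero by blast
  qed
qed

end
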